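(* Let $n,m,s,t \in \mathbb{N}$ satisfy $m,t\leq2^{-20}n$, $s \le n/8$, and $$2^{-10}s\geq\max\big\{ \sqrt{mn},\, \sqrt{tn},\, (n\log n)^{2/3}\big\}.$$ Then there exists a graph $G$ on $n$ vertices with an edge-colouring such that (i) $\delta(G) \ge n/2 + m$; (ii) the colouring of $G$ is proper and $(n/8+s)$-bounded; (iii) every Hamilton cycle in $G$ has at most $n-t$ distinct colours.
   Context: An edge-colouring is proper if any two edges sharing an endpoint receive different colours; it is $b$-bounded if every colour is assigned to at most $b$ edges. $\delta(G)$ is the minimum degree of $G$. *)

theory Defs
  imports Complex_Main
begin

definition simple_graph :: "'a set \<Rightarrow> 'a set set \<Rightarrow> bool" where
  "simple_graph V E \<longleftrightarrow> finite V \<and> (\<forall>e\<in>E. e \<subseteq> V \<and> card e = 2)"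

definition vertex_degree :: "'a set set \<Rightarrow> 'a \<Rightarrow> nat" where
  "vertex_degree E v = card {e \<in> E. v \<in> e}"

text \<open>Meaningful for nonempty finite \<open>V\<close> only.\<close>
definition min_degree :: "'a set \<Rightarrow> 'a set set \<Rightarrow> nat" where
  "min_degree V E = Min (vertex_degree E ` V)"

definition proper_colouring :: "'a set set \<Rightarrow> ('a set \<Rightarrow> 'c) \<Rightarrow> bool" where
  "proper_colouring E c \<longleftrightarrow>
     (\<forall>e\<in>E. \<forall>f\<in>E. e \<noteq> f \<and> e \<inter> f \<noteq> {} \<longrightarrow> c e \<noteq> c f)"

definition bounded_colouring :: "real \<Rightarrow> 'a set set \<Rightarrow> ('a set \<Rightarrow> 'c) \<Rightarrow> bool" where
  "bounded_colouring b E c \<longleftrightarrow> (\<forall>k. real (card {e \<in> E. c e = k}) \<le> b)"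

text \<open>A cycle is given by the list of its vertices in cyclic order; the closing edge joins
  the last vertex to the first.\<close>
definition cycle_edges :: "'a list \<Rightarrow> 'a set set" where
  "cycle_edges vs = {{vs ! i, vs ! (Suc i mod length vs)} | i. i < length vs}"

definition hamilton_cycle :: "'a set \<Rightarrow> 'a set set \<Rightarrow> 'a list \<Rightarrow> bool" where
  "hamilton_cycle V E vs \<longleftrightarrow>
     length vs \<ge> 3 \<and> distinct vs \<and> set vs = V \<and> cycle_edges vs \<subseteq> E"

end

theory Submission
  imports Defs
begin

text \<open>Split the vertices into \<open>A\<close> and \<open>B\<close> with \<open>card A\<close> about \<open>n / 2 + 2 s\<close>, take all edges
  between \<open>A\<close> and \<open>B\<close>, each in a colour of its own, and inside \<open>A\<close> put a sparse regular
  bipartite graph of degree about \<open>2 s + m\<close>. A Hamilton cycle has at least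
  \<open>card A - card B\<close> edges inside \<open>A\<close>, so it suffices to colour the edges inside \<open>A\<close> with only
  \<open>card A - card B - t\<close> colours. The sparse graph joins \<open>x\<close> to \<open>x + i\<close> modulo \<open>M\<close>; listing
  its edges by increasing shift \<open>i\<close> and then by \<open>x\<close>, any fewer than \<open>M\<close> consecutive edges form
  a matching, and the colour classes are consecutive blocks of about \<open>n / 8 + s\<close> edges.\<close>

section \<open>A regular bipartite graph of cyclic shifts\<close>

text \<open>Edge number \<open>j\<close> has \<open>x = j mod M\<close> and shift \<open>i = j div M\<close>.\<close>

definition shift_edge :: "nat \<Rightarrow> nat \<Rightarrow> nat set" where
  "shift_edge M j = {j mod M, M + (j + j div M) mod M}"

text \<open>For \<open>D \<le> M\<close> this is the circulant \<open>D\<close>-regular bipartite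
  graph with sides \<open>{..<M}\<close> and \<open>{M..<2 * M}\<close>.\<close>

definition shift_graph :: "nat \<Rightarrow> nat \<Rightarrow> nat set set" where
  "shift_graph M D = shift_edge M ` {..<D * M}"

definition cross_edges :: "'a set \<Rightarrow> 'a set \<Rightarrow> 'a set set" where
  "cross_edges A B = {{a, b} | a b. a \<in> A \<and> b \<in> B}"

lemma shift_edge_subset: "M > 0 \<Longrightarrow> shift_edge M j \<subseteq> {..<2 * M}"
  by (auto simp: shift_edge_def mult_2 intro: trans_less_add1)

lemma card_shift_edge:
  assumes "M > 0" shows "card (shift_edge M j) = 2"
proof -
  have "j mod M < M" using assms by simp
  hence "j mod M \<noteq> M + (j + j div M) mod M" by linarith
  thus ?thesis by (simp add: shift_edge_def)
qed

lemma mod_neq_of_close: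
  fixes a b M :: nat
  assumes "a < b" "b < a + M" shows "a mod M \<noteq> b mod M"
proof
  assume "a mod M = b mod M"
  hence "M dvd b - a" using assms mod_eq_dvd_iff_nat[of a b M] by auto
  thus False using assms by (auto dest: dvd_imp_le)
qed

lemma add_mod_left_cancel:
  fixes a b c M :: nat
  assumes "(a + b) mod M = (a + c) mod M" "b < M" "c < M"
  shows "b = c"
proof (rule ccontr)
  assume "b \<noteq> c"
  then consider "b < c" | "c < b" by linarith
  thus False
    using assms mod_neq_of_close[of "a + b" "a + c" M] mod_neq_of_close[of "a + c" "a + b" M]
    by cases simp_all
qed

text \<open>Between the two indices the shift grows by at most 1, so the right endpoint advances by
  at most one more than the left one. The spare unit in \<open>Suc j < i + M\<close> keeps both
  advances strictly between \<open>0\<close> and \<open>M\<close>, hence nonzero modulo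
  \<open>M\<close>.\<close>

lemma shift_edge_disjoint:
  assumes "i < j" "Suc j < i + M"
  shows "shift_edge M i \<inter> shift_edge M j = {}"
proof -
  have M: "M > 0" using assms by simp
  have "i div M \<le> j div M" using assms by (simp add: div_le_mono)
  moreover have "j div M \<le> (i + M) div M" using assms by (intro div_le_mono) simp
  hence "j div M \<le> i div M + 1" using M by simp
  ultimately have "(i + i div M) mod M \<noteq> (j + j div M) mod M"
    using assms by (intro mod_neq_of_close) linarith+
  moreover have "i mod M \<noteq> j mod M" using assms by (intro mod_neq_of_close) linarith+
  moreover have "i mod M < M" "j mod M < M" using M by auto
  hence "i mod M \<noteq> M + (j + j div M) mod M" "j mod M \<noteq> M + (i + i div M) mod M" by linarith+
  ultimately show ?thesis unfolding shift_edge_def by auto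
qed

lemma card_le_vertex_degree:
  assumes "finite E" "\<And>w. w \<in> W \<Longrightarrow> {v, w} \<in> E"
  shows "card W \<le> vertex_degree E v"
  unfolding vertex_degree_def
proof (rule card_inj_on_le)
  show "inj_on (\<lambda>w. {v, w}) W" by (auto simp: inj_on_def doubleton_eq_iff)
qed (use assms in auto)

text \<open>A left vertex \<open>v\<close> has the neighbours \<open>M + (v + i) mod M\<close>, and
  a right vertex \<open>M + y\<close> has the residues \<open>y - i\<close> modulo \<open>M\<close>,
  for \<open>i < D\<close>; they are distinct because \<open>D \<le> M\<close>.\<close>

lemma shift_graph_neighbours:
  assumes "M > 0" "D \<le> M" "v < 2 * M"
  obtains W where "W \<subseteq> {..<2 * M}" "card W = D" "\<And>w. w \<in> W \<Longrightarrow> {v, w} \<in> shift_graph M D"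
proof (cases "v < M")
  case True
  let ?f = "\<lambda>i. M + (v + i) mod M"
  have inj: "inj_on ?f {..<D}"
  proof (rule inj_onI)
    fix i j assume ij: "i \<in> {..<D}" "j \<in> {..<D}" "?f i = ?f j"
    hence "(v + i) mod M = (v + j) mod M" by simp
    thus "i = j" by (rule add_mod_left_cancel) (use ij assms in auto)
  qed
  have edge: "{v, ?f i} \<in> shift_graph M D" if "i < D" for i
  proof -
    have "Suc i * M \<le> D * M" using that by (intro mult_le_mono) auto
    \<comment> \<open>\<open>v + i * M\<close> is the index of the edge at the left vertex
      \<open>v\<close> with shift \<open>i\<close>.\<close>
    hence "v + i * M < D * M" using True by simp
    moreover have "(v + i * M + i) mod M = (v + i) mod M"
      by (metis add.assoc add.commute mod_mult_self1)
    hence "shift_edge M (v + i * M) = {v, ?f i}" using True by (simp add: shift_edge_def)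
    ultimately show ?thesis unfolding shift_graph_def by (metis image_eqI lessThan_iff)
  qed
  have lt: "?f i < 2 * M" for i using assms(1) by (simp add: mult_2)
  show thesis
  proof (rule that[of "?f ` {..<D}"])
    show "?f ` {..<D} \<subseteq> {..<2 * M}" using lt by blast
    show "card (?f ` {..<D}) = D" using card_image[OF inj] by simp
    show "{v, w} \<in> shift_graph M D" if "w \<in> ?f ` {..<D}" for w
      using that edge by blast
  qed
next
  case False
  define y where "y = v - M"
  have y: "v = M + y" "y < M" using False assms by (auto simp: y_def)
  \<comment> \<open>Adding \<open>M - i\<close> subtracts \<open>i\<close> modulo \<open>M\<close>
    without truncation.\<close>
  let ?f = "\<lambda>i. (y + (M - i)) mod M"
  have inv: "(?f i + i) mod M = y" if "i < D" for i
  proof -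
    have "(?f i + i) mod M = (y + (M - i) + i) mod M" by (simp add: mod_add_left_eq)
    also have "y + (M - i) + i = y + M" using that assms by simp
    finally show ?thesis using y by simp
  qed
  have inj: "inj_on ?f {..<D}"
  proof (rule inj_onI)
    fix i j assume ij: "i \<in> {..<D}" "j \<in> {..<D}" "?f i = ?f j"
    hence "(?f i + i) mod M = (?f i + j) mod M" using inv[of i] inv[of j] by simp
    thus "i = j" by (rule add_mod_left_cancel) (use ij assms in auto)
  qed
  have edge: "{v, ?f i} \<in> shift_graph M D" if "i < D" for i
  proof -
    have lt: "?f i < M" using assms by simp
    have "Suc i * M \<le> D * M" using that by (intro mult_le_mono) auto
    hence "?f i + i * M < D * M" using lt by simp
    moreover have "(?f i + i * M + i) mod M = (?f i + i) mod M"
      by (metis add.assoc add.commute mod_mult_self1)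
    hence "shift_edge M (?f i + i * M) = {?f i, v}"
      using lt inv[OF that] y by (simp add: shift_edge_def)
    ultimately show ?thesis unfolding shift_graph_def
      by (metis image_eqI insert_commute lessThan_iff)
  qed
  have lt: "?f i < 2 * M" for i
    using assms(1) by (metis mod_less_divisor mult_2 trans_less_add1)
  show thesis
  proof (rule that[of "?f ` {..<D}"])
    show "?f ` {..<D} \<subseteq> {..<2 * M}" using lt by blast
    show "card (?f ` {..<D}) = D" using card_image[OF inj] by simp
    show "{v, w} \<in> shift_graph M D" if "w \<in> ?f ` {..<D}" for w
      using that edge by blast
  qed
qed

section \<open>Hamilton cycles and an unbalanced bipartition\<close>

text \<open>Following the cycle, at most \<open>card B\<close> vertices of \<open>A\<close> are succeeded by a vertex of \<open>B\<close>,
  so at least \<open>card A - card B\<close> edges of the cycle lie inside \<open>A\<close>.\<close>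

lemma hamilton_cycle_colours_le:
  assumes ham: "hamilton_cycle (A \<union> B) E vs"
    and fin: "finite A" "finite B"
    and col: "\<And>e. e \<in> E \<Longrightarrow> e \<subseteq> A \<Longrightarrow> c e < (Q :: nat)"
  shows "card (c ` cycle_edges vs) + card A \<le> Q + card (A \<union> B) + card B"
proof -
  let ?n = "length vs"
  let ?next = "\<lambda>i. vs ! (Suc i mod ?n)"
  let ?e = "\<lambda>i. {vs ! i, ?next i}"
  define S where "S = {i. i < ?n \<and> vs ! i \<in> A \<and> ?next i \<in> A}"
  define T where "T = {i. i < ?n \<and> vs ! i \<in> A \<and> ?next i \<in> B}"
  define IA where "IA = {i. i < ?n \<and> vs ! i \<in> A}"
  have n: "?n \<ge> 3" and dist: "distinct vs" and set: "set vs = A \<union> B"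
    and sub: "cycle_edges vs \<subseteq> E"
    using ham by (auto simp: hamilton_cycle_def)
  have len: "?n = card (A \<union> B)" using dist set distinct_card by metis
  have finS: "finite S" "finite T" "finite IA" by (auto simp: S_def T_def IA_def)
  have next_in: "?next i \<in> A \<union> B" for i
  proof -
    have "Suc i mod ?n < ?n" using n by (intro mod_less_divisor) linarith
    thus ?thesis using set nth_mem by metis
  qed
  have "A \<subseteq> (!) vs ` IA"
  proof
    fix a assume a: "a \<in> A"
    then obtain i where "i < ?n" "vs ! i = a" using set by (metis UnI1 in_set_conv_nth)
    thus "a \<in> (!) vs ` IA" using a by (auto simp: IA_def)
  qed
  hence "card A \<le> card IA" using finS by (meson surj_card_le)
  moreover have "IA \<subseteq> S \<union> T" using next_in by (auto simp: S_def T_def IA_def)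
  hence "card IA \<le> card S + card T"
    using finS by (meson card_Un_le card_mono finite_UnI order_trans)
  moreover have "card T \<le> card B"
  proof (rule card_inj_on_le)
    \<comment> \<open>The vertices of a cycle have distinct successors, so \<open>T\<close> embeds
      into \<open>B\<close>.\<close>
    show "inj_on ?next T"
    proof (rule inj_onI)
      fix i j assume ij: "i \<in> T" "j \<in> T" "?next i = ?next j"
      have "Suc i mod ?n < ?n" "Suc j mod ?n < ?n" using n by (intro mod_less_divisor; linarith)+
      hence "Suc i mod ?n = Suc j mod ?n" using ij dist nth_eq_iff_index_eq by metis
      hence "(1 + i) mod ?n = (1 + j) mod ?n" by simp
      thus "i = j" by (rule add_mod_left_cancel) (use ij in \<open>auto simp: T_def\<close>)
    qed
  qed (use fin in \<open>auto simp: T_def\<close>)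
  ultimately have S: "card A \<le> card S + card B" by simp
  have "c ` cycle_edges vs = (c \<circ> ?e) ` {..<?n}"
    unfolding cycle_edges_def by (auto simp: image_iff)
  \<comment> \<open>The edges at \<open>S\<close> lie inside \<open>A\<close> and share
    \<open>Q\<close> colours; each of the remaining edges adds at most one colour.\<close>
  also have "{..<?n} = S \<union> ({..<?n} - S)" by (auto simp: S_def)
  finally have split: "c ` cycle_edges vs = (c \<circ> ?e) ` S \<union> (c \<circ> ?e) ` ({..<?n} - S)"
    by (simp only: image_Un)
  have "(c \<circ> ?e) ` S \<subseteq> {..<Q}"
  proof
    fix x assume "x \<in> (c \<circ> ?e) ` S"
    then obtain i where i: "i \<in> S" "x = c (?e i)" by auto
    have "?e i \<in> cycle_edges vs" using i(1) by (auto simp: cycle_edges_def S_def)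
    hence "?e i \<in> E" using sub by blast
    moreover have "?e i \<subseteq> A" using i(1) by (auto simp: S_def)
    ultimately show "x \<in> {..<Q}" using col i(2) by simp
  qed
  hence "card ((c \<circ> ?e) ` S) \<le> Q" using card_mono[of "{..<Q}"] by simp
  moreover have "card ((c \<circ> ?e) ` ({..<?n} - S)) \<le> card ({..<?n} - S)"
    by (rule card_image_le) simp
  moreover have "card ({..<?n} - S) + card S = ?n"
    using card_Diff_subset[OF finS(1), of "{..<?n}"] card_mono[of "{..<?n}" S]
    by (force simp: S_def)
  ultimately have "card (c ` cycle_edges vs) + card S \<le> Q + ?n"
    unfolding split using card_Un_le[of "(c \<circ> ?e) ` S" "(c \<circ> ?e) ` ({..<?n} - S)"] by linarith
  thus ?thesis using S len by linarith
qed

section \<open>The coloured graph\<close>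

text \<open>The bound \<open>b < M\<close> makes every block of \<open>b\<close> consecutive shift
  edges a matching, and \<open>D * M \<le> Q * b\<close> makes \<open>Q\<close> blocks enough for
  all of them. The last conclusion is the Hamilton cycle count with \<open>card A = 2 * M\<close>
  and \<open>card B = n - 2 * M\<close>.\<close>

lemma chunked_shift_graph:
  fixes n M D b Q :: nat
  assumes M: "2 * M \<le> n" and D: "D \<le> M" and b: "0 < b" "b < M" and Q: "D * M \<le> Q * b"
  obtains E :: "nat set set" and c :: "nat set \<Rightarrow> nat" where
    "simple_graph {..<n} E"
    "\<And>v. v < 2 * M \<Longrightarrow> D + (n - 2 * M) \<le> vertex_degree E v"
    "\<And>v. 2 * M \<le> v \<Longrightarrow> v < n \<Longrightarrow> 2 * M \<le> vertex_degree E v"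
    "proper_colouring E c"
    "\<And>k. card {e \<in> E. c e = k} \<le> b"
    "\<And>vs. hamilton_cycle {..<n} E vs \<Longrightarrow> card (c ` cycle_edges vs) + 4 * M \<le> Q + 2 * n"
proof -
  have M0: "M > 0" using b by simp
  define A where "A = {..<2 * M}"
  define B where "B = {2 * M..<n}"
  define F where "F = shift_graph M D"
  define C where "C = cross_edges A B"
  define E where "E = F \<union> C"
  have AB: "A \<union> B = {..<n}" "A \<inter> B = {}" "finite A" "finite B"
    using M by (auto simp: A_def B_def)
  have F_sub: "e \<subseteq> A" if "e \<in> F" for e
    using that shift_edge_subset[OF M0] by (auto simp: F_def shift_graph_def A_def)
  have C_not_sub: "\<not> e \<subseteq> A" if "e \<in> C" for e
    using that AB by (auto simp: C_def cross_edges_def)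
  have finF: "finite F" by (simp add: F_def shift_graph_def)
  have "C \<subseteq> Pow (A \<union> B)" by (auto simp: C_def cross_edges_def)
  hence finC: "finite C" using AB by (meson finite_Pow_iff finite_UnI finite_subset)
  have finE: "finite E" using finF finC by (simp add: E_def)
  obtain h :: "nat set \<Rightarrow> nat" where h: "inj_on h C"
    using finite_imp_inj_to_nat_seg[OF finC] by blast
  \<comment> \<open>A chosen index for each edge of \<open>F\<close>. Distinct edges have distinct
    indices, since \<open>shift_edge M\<close> recovers the edge from its index.\<close>
  define r where "r = inv_into {..<D * M} (shift_edge M)"
  \<comment> \<open>Inside \<open>A\<close> the colour is the number of the block; the offset
    \<open>Q\<close> keeps the colours of the cross edges apart from these.\<close>
  define c where "c e = (if e \<subseteq> A then r e div b else Q + h e)" for e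
  have r: "r e < D * M" "shift_edge M (r e) = e" if "e \<in> F" for e
    using that inv_into_into[of e "shift_edge M" "{..<D * M}"]
      f_inv_into_f[of e "shift_edge M" "{..<D * M}"]
    by (auto simp: F_def shift_graph_def r_def)
  have cF: "c e = r e div b" if "e \<in> F" for e using F_sub[OF that] by (simp add: c_def)
  have cC: "c e = Q + h e" if "e \<in> C" for e using C_not_sub[OF that] by (simp add: c_def)
  have cF_lt: "c e < Q" if "e \<in> F" for e
  proof -
    have "r e < Q * b" using r(1)[OF that] Q by linarith
    thus ?thesis using cF[OF that] by (simp add: less_mult_imp_div_less)
  qed
  have simple: "simple_graph {..<n} E"
  proof -
    have "e \<subseteq> {..<n} \<and> card e = 2" if "e \<in> F" for e
      using F_sub[OF that] that AB card_shift_edge[OF M0] by (auto simp: F_def shift_graph_def)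
    moreover have "e \<subseteq> {..<n} \<and> card e = 2" if e: "e \<in> C" for e
    proof -
      obtain a b where "e = {a, b}" "a \<in> A" "b \<in> B"
        using e by (auto simp: C_def cross_edges_def)
      moreover from this have "a \<noteq> b" using AB(2) by blast
      ultimately show ?thesis using AB(1) by auto
    qed
    ultimately show ?thesis by (auto simp: simple_graph_def E_def)
  qed
  have degA: "D + (n - 2 * M) \<le> vertex_degree E v" if v: "v < 2 * M" for v
  proof -
    obtain W where W: "W \<subseteq> A" "card W = D" "\<And>w. w \<in> W \<Longrightarrow> {v, w} \<in> F"
      unfolding A_def F_def by (rule shift_graph_neighbours[OF M0 D v]) blast
    have "card (W \<union> B) = card W + card B"
      using W(1) AB by (intro card_Un_disjoint) (auto intro: finite_subset)
    moreover have "card (W \<union> B) \<le> vertex_degree E v"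
      using W v finE
      by (intro card_le_vertex_degree) (auto simp: E_def C_def cross_edges_def A_def)
    ultimately show ?thesis using W(2) by (simp add: B_def)
  qed
  have degB: "2 * M \<le> vertex_degree E v" if v: "2 * M \<le> v" "v < n" for v
  proof -
    have "v \<in> B" using v by (simp add: B_def)
    hence "{v, w} \<in> E" if "w \<in> A" for w
      using that unfolding E_def C_def cross_edges_def by (auto simp: insert_commute)
    hence "card A \<le> vertex_degree E v" by (intro card_le_vertex_degree finE)
    thus ?thesis by (simp add: A_def)
  qed
  have F_disj: "e \<inter> f = {}" if ef: "e \<in> F" "f \<in> F" "c e = c f" "r e < r f" for e f
  proof -
    have eq: "r e div b = r f div b" using ef cF by simp
    have "r f < r f div b * b + b" using b by (metis add.commute dividend_less_div_times)
    moreover have "r f div b * b \<le> r e" using eq by (metis div_times_less_eq_dividend)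
    \<comment> \<open>Two indices in one block differ by at most \<open>b - 1\<close>, so
      \<open>b < M\<close> leaves the spare unit that disjointness requires.\<close>
    ultimately have "Suc (r f) < r e + M" using b by linarith
    hence "shift_edge M (r e) \<inter> shift_edge M (r f) = {}"
      using ef(4) by (intro shift_edge_disjoint)
    thus ?thesis using r ef by simp
  qed
  have proper: "proper_colouring E c"
    unfolding proper_colouring_def
  proof (intro ballI impI notI)
    fix e f assume ef: "e \<in> E" "f \<in> E" "e \<noteq> f \<and> e \<inter> f \<noteq> {}" "c e = c f"
    consider "e \<in> F" "f \<in> F" | "e \<in> C" "f \<in> C" | "e \<in> F" "f \<in> C" | "e \<in> C" "f \<in> F"
      using ef by (auto simp: E_def)
    thus False
    proof cases
      case 1
      hence "r e \<noteq> r f" using ef r(2) by metis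
      hence "r e < r f \<or> r f < r e" by linarith
      thus False using F_disj 1 ef by (metis inf_commute)
    next
      case 2
      thus False using ef cC h by (auto dest: inj_onD)
    next
      case 3
      thus False using cF_lt[of e] cC[of f] ef by simp
    next
      case 4
      thus False using cF_lt[of f] cC[of e] ef by simp
    qed
  qed
  have bounded: "card {e \<in> E. c e = k} \<le> b" for k
  proof (cases "k < Q")
    case True
    have "{e \<in> E. c e = k} \<subseteq> shift_edge M ` {k * b..<k * b + b}"
    proof
      fix e assume "e \<in> {e \<in> E. c e = k}"
      hence e: "e \<in> F" "c e = k" using True cC by (auto simp: E_def)
      hence k: "r e div b = k" using cF by simp
      have "r e < k * b + b" using b k by (metis add.commute dividend_less_div_times)
      moreover have "k * b \<le> r e" using k by (metis div_times_less_eq_dividend)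
      ultimately show "e \<in> shift_edge M ` {k * b..<k * b + b}"
        using r(2)[OF e(1)] by (metis atLeastLessThan_iff image_eqI)
    qed
    hence "card {e \<in> E. c e = k} \<le> card {k * b..<k * b + b}"
      by (meson finite_atLeastLessThan surj_card_le)
    thus ?thesis by simp
  next
    case False
    \<comment> \<open>A colour from \<open>Q\<close> upwards occurs on cross edges only, where
      \<open>h\<close> is injective, so its class has at most one edge.\<close>
    hence in_C: "e \<in> C" if "e \<in> E" "c e = k" for e
      using that cF_lt unfolding E_def by blast
    have "e = f" if "e \<in> E" "c e = k" "f \<in> E" "c f = k" for e f
    proof (rule inj_onD[OF h])
      show "h e = h f" using that cC[OF in_C[of e]] cC[OF in_C[of f]] by simp
    qed (use in_C that in blast)+
    hence "\<forall>e\<in>{e \<in> E. c e = k}. \<forall>f\<in>{e \<in> E. c e = k}. e = f" by blast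
    moreover have "finite {e \<in> E. c e = k}" using finE by simp
    ultimately have "card {e \<in> E. c e = k} \<le> Suc 0" by (simp only: card_le_Suc0_iff_eq)
    thus ?thesis using b by simp
  qed
  have ham: "card (c ` cycle_edges vs) + 4 * M \<le> Q + 2 * n" if "hamilton_cycle {..<n} E vs" for vs
  proof -
    have "c e < Q" if "e \<in> E" "e \<subseteq> A" for e using that cF_lt C_not_sub by (auto simp: E_def)
    hence "card (c ` cycle_edges vs) + card A \<le> Q + card (A \<union> B) + card B"
      using that AB by (intro hamilton_cycle_colours_le[where E = E]) auto
    thus ?thesis using AB(1) M by (simp add: A_def B_def)
  qed
  show thesis using simple degA degB proper bounded ham by (rule that)
qed

section \<open>Numerical bounds on the parameters\<close>

text \<open>In the second bound both sides have main term \<open>n s / 2\<close>; the right-hand side wins by a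
  multiple of \<open>s\<^sup>2\<close>, which dominates \<open>m n\<close>, \<open>t n\<close> and \<open>n\<close>.\<close>

lemma parameter_bounds:
  fixes n m s t :: nat
  defines "M \<equiv> n div 4 + s" and "b \<equiv> n div 8 + s"
  defines "D \<equiv> 2 * M - n div 2 + m" and "Q \<equiv> 4 * M - n - t"
  assumes s: "8 * s \<le> n" "2 ^ 10 \<le> s"
    and sq: "2 ^ 20 * (m * n) \<le> s\<^sup>2" "2 ^ 20 * (t * n) \<le> s\<^sup>2" "2 ^ 10 * n \<le> s\<^sup>2"
    and mt: "2 ^ 10 * m \<le> s" "2 ^ 10 * t \<le> s"
  shows "D \<le> M" "D * M \<le> Q * b"
proof -
  show "D \<le> M" using s mt unfolding D_def M_def by simp
  define u where "u = real n / 4"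
  have "D \<le> 2 * s + m + 1" unfolding D_def M_def by simp
  hence "real D \<le> 2 * real s + real m + 1" by linarith
  moreover have "real M \<le> u + real s" unfolding M_def u_def by linarith
  ultimately have upper: "real D * real M \<le> (2 * real s + real m + 1) * (u + real s)"
    by (intro mult_mono) (auto simp: u_def)
  \<comment> \<open>The 3 is the largest possible loss in \<open>4 * (n div 4)\<close>.\<close>
  have "4 * s \<le> Q + 3 + t" unfolding Q_def M_def by simp
  hence "4 * real s - 3 - real t \<le> real Q" by linarith
  moreover have "u / 2 + real s - 1 \<le> real b" unfolding b_def u_def by linarith
  ultimately have lower: "(4 * real s - 3 - real t) * (u / 2 + real s - 1) \<le> real Q * real b"
    using s mt by (intro mult_mono) (auto simp: u_def)
  have "(2 * real s + real m + 1) * (u + real s)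
      \<le> (4 * real s - 3 - real t) * (u / 2 + real s - 1)"
  proof -
    have rsq: "real m * u \<le> (real s)\<^sup>2 / 1048576" "real t * u \<le> (real s)\<^sup>2 / 1048576"
      "u \<le> (real s)\<^sup>2 / 1024"
      using sq[THEN of_nat_mono[where 'a = real]] unfolding u_def
      by (auto simp: mult.commute)
    have "2 ^ 10 * m * s \<le> s * s" "2 ^ 10 * t * s \<le> s * s" "2 ^ 10 * s \<le> s * s"
      using mt s(2) by (intro mult_le_mono1; simp)+
    from this[THEN of_nat_mono[where 'a = real]]
    have "real m * real s \<le> (real s)\<^sup>2 / 1024" "real t * real s \<le> (real s)\<^sup>2 / 1024"
      "real s \<le> (real s)\<^sup>2 / 1024"
      by (auto simp: power2_eq_square)
    \<comment> \<open>The terms \<open>2 * s * u\<close> cancel and \<open>2 * s\<^sup>2\<close>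
      survives; the negative terms together amount to a small fraction of
      \<open>s\<^sup>2\<close>.\<close>
    moreover have "(4 * real s - 3 - real t) * (u / 2 + real s - 1)
        - (2 * real s + real m + 1) * (u + real s)
      = 2 * (real s)\<^sup>2 - 8 * real s - 5 / 2 * u + 3 - real t * u / 2 - real t * real s + real t
        - real m * u - real m * real s"
      by (simp add: field_simps power2_eq_square)
    ultimately show ?thesis
      using rsq of_nat_0_le_iff[of t, where 'a = real] zero_le_power2[of "real s"]
      by linarith
  qed
  with upper lower have "real (D * M) \<le> real (Q * b)" by simp
  thus "D * M \<le> Q * b" by (simp only: of_nat_le_iff)
qed

text \<open>First \<open>n * ln n \<ge> n - 1 \<ge> 1\<close> forces \<open>s\<close> to be at least
  \<open>2 ^ 10\<close>. Then \<open>s \<le> n / 8\<close> makes \<open>n\<close> large enough for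
  \<open>ln n \<ge> 1\<close>, and squaring
  \<open>sqrt n \<le> n powr (2 / 3) \<le> s / 2 ^ 10\<close> gives more than the second
  bound.\<close>

lemma powr_two_thirds_bound:
  fixes n s :: nat
  assumes "n \<ge> 2" "real s \<le> real n / 8"
    "(real n * ln (real n)) powr (2 / 3) \<le> real s / 2 ^ 10"
  shows "2 ^ 10 \<le> s" "2 ^ 10 * n \<le> s\<^sup>2"
proof -
  \<comment> \<open>The bound \<open>ln x \<le> x - 1\<close> at \<open>x = 1 / n\<close> turns into
    a lower bound for \<open>ln n\<close>.\<close>
  have "ln (inverse (real n)) \<le> inverse (real n) - 1"
    using assms by (intro ln_le_minus_one) simp
  hence "1 - inverse (real n) \<le> ln (real n)" using assms by (simp add: ln_inverse)
  hence "real n * (1 - inverse (real n)) \<le> real n * ln (real n)" by (rule mult_left_mono) simp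
  moreover have "real n * (1 - inverse (real n)) = real n - 1"
    using assms by (simp add: field_simps)
  ultimately have "1 \<le> real n * ln (real n)" using assms by simp
  hence "1 \<le> (real n * ln (real n)) powr (2 / 3)" by (simp add: ge_one_powr_ge_zero)
  hence s: "2 ^ 10 \<le> real s" using assms(3) by simp
  thus "2 ^ 10 \<le> s" by simp
  have n: "real n \<ge> 3" using s assms(2) by simp
  have "1 \<le> ln (real n)" using n exp_le by (simp add: ln_ge_iff)
  hence le: "real n \<le> real n * ln (real n)" using n by simp
  have "sqrt (real n) = real n powr (1 / 2)" using n by (simp add: powr_half_sqrt)
  also have "\<dots> \<le> real n powr (2 / 3)" using n by (intro powr_mono) auto
  also have "\<dots> \<le> (real n * ln (real n)) powr (2 / 3)" using le by (intro powr_mono2) auto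
  also have "\<dots> \<le> real s / 2 ^ 10" by (rule assms(3))
  finally have "(sqrt (real n))\<^sup>2 \<le> (real s / 2 ^ 10)\<^sup>2" by (intro power_mono) auto
  hence "real (2 ^ 10 * n) \<le> real (s\<^sup>2)" by (simp add: power_divide)
  thus "2 ^ 10 * n \<le> s\<^sup>2" by (simp only: of_nat_le_iff)
qed

text \<open>This serves both \<open>k = m\<close> and \<open>k = t\<close>. Squaring gives the first
  bound; the second follows from \<open>k = sqrt (k * k) \<le> sqrt (k * n)\<close>.\<close>

lemma sqrt_mult_bound:
  fixes n k s :: nat
  assumes "sqrt (real k * real n) \<le> real s / 2 ^ 10" "k \<le> n"
  shows "2 ^ 20 * (k * n) \<le> s\<^sup>2" "2 ^ 10 * k \<le> s"
proof -
  have "(sqrt (real k * real n))\<^sup>2 \<le> (real s / 2 ^ 10)\<^sup>2"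
    using assms(1) by (intro power_mono) auto
  hence "real (2 ^ 20 * (k * n)) \<le> real (s\<^sup>2)" by (simp add: power_divide)
  thus "2 ^ 20 * (k * n) \<le> s\<^sup>2" by (simp only: of_nat_le_iff)
  have "real k = sqrt (real k * real k)" by simp
  also have "\<dots> \<le> sqrt (real k * real n)" using assms(2) by (intro real_sqrt_le_mono mult_left_mono) auto
  finally have "real (2 ^ 10 * k) \<le> real s" using assms(1) by simp
  thus "2 ^ 10 * k \<le> s" by (simp only: of_nat_le_iff)
qed

section \<open>Choice of parameters and conclusion\<close>

theorem theorem5p1:
  fixes n m s t :: nat
  assumes "n \<ge> 2"
    and "real m \<le> real n / 2 ^ 20" and "real t \<le> real n / 2 ^ 20"
    and "real s \<le> real n / 8"
    and "real s / 2 ^ 10 \<ge>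
      max (sqrt (real m * real n))
        (max (sqrt (real t * real n)) ((real n * ln (real n)) powr (2 / 3)))"
  shows "\<exists>(V :: nat set) (E :: nat set set) (c :: nat set \<Rightarrow> nat).
    simple_graph V E \<and> card V = n \<and>
    real (min_degree V E) \<ge> real n / 2 + real m \<and>
    proper_colouring E c \<and> bounded_colouring (real n / 8 + real s) E c \<and>
    (\<forall>vs. hamilton_cycle V E vs \<longrightarrow>
       real (card (c ` cycle_edges vs)) \<le> real n - real t)"
proof -
  have sqm: "sqrt (real m * real n) \<le> real s / 2 ^ 10"
    and sqt: "sqrt (real t * real n) \<le> real s / 2 ^ 10"
    and pw: "(real n * ln (real n)) powr (2 / 3) \<le> real s / 2 ^ 10"
    using assms(5) by auto
  have "m \<le> n" "t \<le> n" using assms(2,3) by simp_all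
  note m = sqrt_mult_bound[OF sqm \<open>m \<le> n\<close>] and t = sqrt_mult_bound[OF sqt \<open>t \<le> n\<close>]
  note s = powr_two_thirds_bound[OF assms(1,4) pw]
  have sn: "8 * s \<le> n" using assms(4) by simp
  \<comment> \<open>The sides have sizes \<open>2 * M\<close> and \<open>n - 2 * M\<close>.
    \<open>D\<close> raises the degrees in \<open>A\<close> from \<open>n - 2 * M\<close> to
    \<open>n - n div 2 + m\<close>, and \<open>Q\<close> is the difference of the two sizes minus
    \<open>t\<close>.\<close>
  define M where "M = n div 4 + s"
  define b where "b = n div 8 + s"
  define D where "D = 2 * M - n div 2 + m"
  define Q where "Q = 4 * M - n - t"
  have D: "D \<le> M" and Q: "D * M \<le> Q * b"
    using parameter_bounds[OF sn s(1) m(1) t(1) s(2) m(2) t(2)]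
    by (simp_all only: M_def b_def D_def Q_def)
  have M: "2 * M \<le> n" and b: "0 < b" "b < M"
    using sn s(1) unfolding M_def b_def by simp_all
  obtain E and c :: "nat set \<Rightarrow> nat" where G: "simple_graph {..<n} E"
    "\<And>v. v < 2 * M \<Longrightarrow> D + (n - 2 * M) \<le> vertex_degree E v"
    "\<And>v. 2 * M \<le> v \<Longrightarrow> v < n \<Longrightarrow> 2 * M \<le> vertex_degree E v"
    "proper_colouring E c"
    "\<And>k. card {e \<in> E. c e = k} \<le> b"
    "\<And>vs. hamilton_cycle {..<n} E vs \<Longrightarrow> card (c ` cycle_edges vs) + 4 * M \<le> Q + 2 * n"
    by (rule chunked_shift_graph[OF M D b Q]) (rule that; assumption)
  have "n + 2 * m \<le> 2 * (D + (n - 2 * M))" "n + 2 * m \<le> 4 * M"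
    using sn s(1) m(2) unfolding D_def M_def by simp_all
  hence "n + 2 * m \<le> 2 * vertex_degree E v" if "v < n" for v
    using G(2)[of v] G(3)[of v] that by (cases "v < 2 * M") fastforce+
  hence deg: "real n / 2 + real m \<le> real (vertex_degree E v)" if "v < n" for v
    using that by fastforce
  have "vertex_degree E ` {..<n} \<noteq> {}" using assms(1) by (simp add: lessThan_empty_iff)
  hence "min_degree {..<n} E \<in> vertex_degree E ` {..<n}"
    unfolding min_degree_def by (intro Min_in) auto
  hence min: "real n / 2 + real m \<le> real (min_degree {..<n} E)" using deg by auto
  have "real b \<le> real n / 8 + real s" unfolding b_def by linarith
  hence "bounded_colouring (real n / 8 + real s) E c"
    unfolding bounded_colouring_def using G(5) by (meson of_nat_le_iff order_trans)
  moreover have "real (card (c ` cycle_edges vs)) \<le> real n - real t"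
    if "hamilton_cycle {..<n} E vs" for vs
  proof -
    \<comment> \<open>This makes the natural-number subtractions in \<open>Q\<close> exact.\<close>
    have "n + t \<le> 4 * M" using sn s(1) t(2) unfolding M_def by simp
    hence "card (c ` cycle_edges vs) + t \<le> n" using G(6)[OF that] M unfolding Q_def by simp
    thus ?thesis by linarith
  qed
  ultimately show ?thesis using G(1,4) min
    by (intro exI[of _ "{..<n}"] exI[of _ E] exI[of _ c]) simp
qed

end
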